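(* Let $D = \{d_1 \ge d_2 \ge \cdots \ge d_m\}$ be a (multi)set of positive integers. Then the chain graph $G_D$ is, up to isomorphism, the unique graph in $\mathscr{B}_D$ that solves the maximum problem $\max_{G \in \mathscr{B}_D} \lambda_{\max}(G)$.
   Context: All graphs are finite, simple and undirected. A bipartite graph is written $G = (V \cup W, E)$ with given sides $V=\{v_1,\dots,v_m\}$, $W=\{w_1,\dots,w_n\}$ and $E \subseteq V \times W$; $\lambda_{\max}(G)$ is the largest eigenvalue of its adjacency matrix. $D(G)$ is the multiset of degrees of the vertices in $V$, arranged in non-increasing order. For a multiset $D=\{d_1 \ge \cdots \ge d_m\}$ of positive integers, $\mathscr{B}_D$ is the class of all bipartite graphs $G$ with no isolated vertices and $D(G) = D$ (the size $n$ of $W$ is not prescribed). The chain graph $G_D \in \mathscr{B}_D$ has sides $\{v_1,\dots,v_m\}$ and $\{w_1,\dots,w_{n}\}$ with $n=d_1$, and the neighbors of $v_i$ are exactly $w_1, w_2, \dots, w_{d_i}$. *)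

theory Defs
  imports "Jordan_Normal_Form.Spectral_Radius" "HOL-Library.Multiset"
begin

(* A bipartite graph with given sides V = {v_0, ..., v_{m-1}} (m = left_size) and
   W = {w_0, ..., w_{n-1}} (n = right_size); vertices are represented by their indices,
   and the pair (i, j) stands for the edge joining v_i and w_j. *)
record bigraph =
  left_size :: nat
  right_size :: nat
  edges :: "(nat \<times> nat) set"

definition wf_bigraph :: "bigraph \<Rightarrow> bool" where
  "wf_bigraph G \<longleftrightarrow> edges G \<subseteq> {..<left_size G} \<times> {..<right_size G}"

definition left_degree :: "bigraph \<Rightarrow> nat \<Rightarrow> nat" where
  "left_degree G i = card {j. (i, j) \<in> edges G}"

definition left_degrees :: "bigraph \<Rightarrow> nat multiset" where
  "left_degrees G = image_mset (left_degree G) (mset_set {..<left_size G})"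

definition no_isolated_vertices :: "bigraph \<Rightarrow> bool" where
  "no_isolated_vertices G \<longleftrightarrow>
     (\<forall>i<left_size G. \<exists>j. (i, j) \<in> edges G) \<and> (\<forall>j<right_size G. \<exists>i. (i, j) \<in> edges G)"

definition bigraph_class :: "nat multiset \<Rightarrow> bigraph set" where
  "bigraph_class D = {G. wf_bigraph G \<and> no_isolated_vertices G \<and> left_degrees G = D}"

(* Rows and columns are indexed by v_0, ..., v_{m-1}, w_0, ..., w_{n-1} in this order. *)
definition adjacency_mat :: "bigraph \<Rightarrow> real mat" where
  "adjacency_mat G =
     (let m = left_size G; n = right_size G in
      mat (m + n) (m + n)
        (\<lambda>(p, q). if (p < m \<and> m \<le> q \<and> (p, q - m) \<in> edges G) \<or>
                    (q < m \<and> m \<le> p \<and> (q, p - m) \<in> edges G)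
                 then 1 else 0))"

(* The matrix is real symmetric, so its spectrum over the reals contains all its
   eigenvalues; it is finite, and nonempty as soon as G has a vertex. *)
definition lambda_max :: "bigraph \<Rightarrow> real" where
  "lambda_max G = Max (spectrum (adjacency_mat G))"

(* Isomorphism of bipartite graphs with given sides: V is mapped to V and W to W. *)
definition bigraph_iso :: "bigraph \<Rightarrow> bigraph \<Rightarrow> bool" where
  "bigraph_iso G H \<longleftrightarrow>
     (\<exists>f g. bij_betw f {..<left_size G} {..<left_size H} \<and>
            bij_betw g {..<right_size G} {..<right_size H} \<and>
            (\<forall>i<left_size G. \<forall>j<right_size G.
               (i, j) \<in> edges G \<longleftrightarrow> (f i, g j) \<in> edges H))"

(* Meant for nonempty non-increasing lists: the i-th entry is then the degree of v_i, and
   the number of vertices in W is the first (largest) entry. *)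
definition chain_graph :: "nat list \<Rightarrow> bigraph" where
  "chain_graph ds =
     \<lparr>left_size = length ds, right_size = hd ds,
      edges = {(i, j). i < length ds \<and> j < ds ! i}\<rparr>"

end

theory Submission
  imports Defs "HOL-Analysis.Function_Topology"
begin

text \<open>
  For a bipartite graph with biadjacency matrix \<open>B\<close>, \<open>\<lambda>\<^sub>m\<^sub>a\<^sub>x\<^sup>2\<close> is the largest eigenvalue, hence the
  maximal Rayleigh quotient, of the matrix \<open>B B\<^sup>T\<close> on \<open>V\<close>, whose entries are the codegrees
  \<open>|N(v\<^sub>i) \<inter> N(v\<^sub>k)|\<close>. These are at most \<open>min d\<^sub>i d\<^sub>k\<close>, with equality everywhere for the chain graph, so
  the Rayleigh quotient at the absolute values of an eigenvector only grows on passing to the chain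
  graph. In the case of equality that vector is an eigenvector of the positive matrix
  \<open>(min d\<^sub>i d\<^sub>k)\<close>, so it is positive, all codegrees attain their bound, and the neighbourhoods are
  nested.
\<close>

section \<open>Quadratic forms and their maximizers on the unit sphere\<close>

definition quad_form :: "nat \<Rightarrow> (nat \<Rightarrow> nat \<Rightarrow> real) \<Rightarrow> (nat \<Rightarrow> real) \<Rightarrow> real" where
  "quad_form m M x = (\<Sum>i<m. \<Sum>k<m. M i k * x i * x k)"

lemma quad_form_cong:
  "(\<And>i. i < m \<Longrightarrow> x i = y i) \<Longrightarrow> quad_form m M x = quad_form m M y"
  by (simp add: quad_form_def)

lemma quad_form_scale: "quad_form m M (\<lambda>i. c * x i) = c\<^sup>2 * quad_form m M x"
  by (simp add: quad_form_def sum_distrib_left power2_eq_square mult_ac)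

lemma quad_form_eq_sum_mult:
  "quad_form m M x = (\<Sum>i<m. x i * (\<Sum>k<m. M i k * x k))"
  by (simp add: quad_form_def sum_distrib_left mult_ac)

lemma quad_form_eigenvector:
  assumes "\<forall>i<m. (\<Sum>k<m. M i k * x k) = r * x i"
  shows "quad_form m M x = r * (\<Sum>i<m. (x i)\<^sup>2)"
  using assms
  by (simp add: quad_form_eq_sum_mult sum_distrib_left power2_eq_square mult_ac)

text \<open>Symmetry merges the two mixed terms into one. This is the expansion along a line from
  which the first-order condition at a maximizer is read off.\<close>

lemma quad_form_add_scaled:
  assumes sym: "\<And>i k. M i k = M k i"
  shows "quad_form m M (\<lambda>i. x i + t * h i) =
    quad_form m M x + 2 * t * (\<Sum>i<m. h i * (\<Sum>k<m. M i k * x k)) + t\<^sup>2 * quad_form m M h"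
proof -
  have "(\<Sum>i<m. \<Sum>k<m. M i k * h i * x k) = (\<Sum>i<m. h i * (\<Sum>k<m. M i k * x k))"
    by (simp add: sum_distrib_left mult_ac)
  moreover have "(\<Sum>i<m. \<Sum>k<m. M i k * x i * h k) = (\<Sum>i<m. \<Sum>k<m. M i k * h i * x k)"
  proof (subst sum.swap, intro sum.cong refl)
    show "M k i * x k * h i = M i k * h i * x k" for i k
      using sym[of k i] by simp
  qed
  moreover have "quad_form m M (\<lambda>i. x i + t * h i) =
      (\<Sum>i<m. \<Sum>k<m. M i k * x i * x k + t * (M i k * x i * h k)
        + t * (M i k * h i * x k) + t\<^sup>2 * (M i k * h i * h k))"
    unfolding quad_form_def by (intro sum.cong refl) (simp add: algebra_simps power2_eq_square)
  moreover have "\<dots> = quad_form m M x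
      + t * (\<Sum>i<m. \<Sum>k<m. M i k * x i * h k)
      + t * (\<Sum>i<m. \<Sum>k<m. M i k * h i * x k) + t\<^sup>2 * quad_form m M h"
    unfolding quad_form_def by (simp only: sum.distrib sum_distrib_left)
  ultimately show ?thesis
    by simp
qed

lemma continuous_on_quad_form: "continuous_on S (quad_form m M)"
proof -
  have "continuous_on S (\<lambda>x::nat \<Rightarrow> real. \<Sum>i<m. \<Sum>k<m. M i k * x i * x k)"
    by (intro continuous_intros continuous_on_product_coordinates
        continuous_on_subset[OF continuous_on_product_coordinates] subset_UNIV)
  then show ?thesis
    by (simp add: quad_form_def[abs_def])
qed

text \<open>The unit sphere is compact and the form is continuous, so a maximum is attained there;
  homogeneity of degree two carries the bound over to every \<open>y\<close>.\<close>

lemma quad_form_maximizer: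
  assumes "m > 0"
  obtains x where "(\<Sum>i<m. (x i)\<^sup>2) = 1"
    and "\<And>y. quad_form m M y \<le> quad_form m M x * (\<Sum>i<m. (y i)\<^sup>2)"
proof -
  \<comment> \<open>Vectors are functions on all of \<open>nat\<close>. Pinning the coordinates from
    \<open>m\<close> on to 0 makes the box a product of compact sets, hence compact by Tychonoff,
    and the form ignores those coordinates.\<close>
  define B where "B = (\<lambda>i. if i < m then {-1..1} else {0::real})"
  define S where "S = Pi\<^sub>E UNIV B \<inter> {x. (\<Sum>i<m. (x i)\<^sup>2) = 1}"
  have "compactin (product_topology (\<lambda>_. euclidean) UNIV) (Pi\<^sub>E UNIV B)"
    by (subst compactin_PiE) (auto simp: B_def)
  then have "compact (Pi\<^sub>E UNIV B)"
    by (simp add: euclidean_product_topology)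
  moreover have "closed {x::nat \<Rightarrow> real. (\<Sum>i<m. (x i)\<^sup>2) = 1}"
    by (intro closed_Collect_eq continuous_intros continuous_on_product_coordinates)
  ultimately have "compact S"
    unfolding S_def by (rule compact_Int_closed)
  have mem: "(\<lambda>i. if i < m then z i else 0) \<in> S" if "(\<Sum>i<m. (z i)\<^sup>2) = 1" for z
  proof -
    have "\<bar>z i\<bar> \<le> 1" if "i < m" for i
    proof -
      have "(z i)\<^sup>2 \<le> (\<Sum>i<m. (z i)\<^sup>2)"
        using that by (intro member_le_sum) auto
      then show ?thesis
        using \<open>(\<Sum>i<m. (z i)\<^sup>2) = 1\<close> by (simp add: abs_square_le_1)
    qed
    then show ?thesis
      using that by (auto simp: S_def B_def abs_le_iff minus_le_iff)
  qed
  have "(\<Sum>i<m. (if i = 0 then 1 else 0::real)\<^sup>2) = (\<Sum>i<m. if i = 0 then 1 else 0)"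
    by (intro sum.cong) auto
  also have "\<dots> = 1"
    using assms by simp
  finally have "S \<noteq> {}"
    using mem[of "\<lambda>i. if i = 0 then 1 else 0"] by auto
  then obtain x where "x \<in> S" and max: "\<forall>y\<in>S. quad_form m M y \<le> quad_form m M x"
    using continuous_attains_sup[OF \<open>compact S\<close> _ continuous_on_quad_form] by blast
  have "quad_form m M y \<le> quad_form m M x * (\<Sum>i<m. (y i)\<^sup>2)" for y
  proof (cases "(\<Sum>i<m. (y i)\<^sup>2) = 0")
    case True
    then have "\<forall>i<m. y i = 0"
      by (subst (asm) sum_nonneg_eq_0_iff) auto
    then show ?thesis
      by (simp add: quad_form_def)
  next
    case False
    define c where "c = sqrt (\<Sum>i<m. (y i)\<^sup>2)"
    have c2: "c\<^sup>2 = (\<Sum>i<m. (y i)\<^sup>2)"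
      by (simp add: c_def sum_nonneg)
    then have "c \<noteq> 0"
      using False by auto
    define z where "z = (\<lambda>i. inverse c * y i)"
    have "(\<Sum>i<m. (z i)\<^sup>2) = 1"
      using \<open>c \<noteq> 0\<close> 
      unfolding z_def power_mult_distrib sum_distrib_left[symmetric] c2[symmetric]
      by (simp add: power_inverse)
    then have "quad_form m M z \<le> quad_form m M x"
      using max mem[of z] quad_form_cong[of m z "\<lambda>i. if i < m then z i else 0" M] by auto
    moreover have "quad_form m M y = c\<^sup>2 * quad_form m M z"
      using \<open>c \<noteq> 0\<close> by (simp add: z_def quad_form_scale power_inverse)
    ultimately show ?thesis
      by (simp add: c2[symmetric] mult.commute mult_right_mono)
  qed
  moreover have "(\<Sum>i<m. (x i)\<^sup>2) = 1"
    using \<open>x \<in> S\<close> by (simp add: S_def)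
  ultimately show ?thesis
    using that by blast
qed

text \<open>For small \<open>t\<close> the linear term dominates and changes sign with
  \<open>t\<close>. The choice \<open>t = - a / (b + 1)\<close> makes this explicit: the value there
  is \<open>- u^2 * (b + 2)\<close> with \<open>u = a / (b + 1)\<close>.\<close>

lemma quadratic_nonneg_imp_zero:
  fixes a b :: real
  assumes "\<And>t. 0 \<le> 2 * t * a + t\<^sup>2 * b" and "b \<ge> 0"
  shows "a = 0"
proof -
  define u where "u = a / (b + 1)"
  have a: "a = u * (b + 1)"
    using \<open>b \<ge> 0\<close> by (simp add: u_def)
  have "0 \<le> - (u\<^sup>2 * (b + 2))"
    using assms(1)[of "- u"] unfolding a by (simp add: algebra_simps power2_eq_square)
  then have "u = 0"
    using \<open>b \<ge> 0\<close> by (simp add: mult_le_0_iff)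
  then show ?thesis
    by (simp add: a)
qed

text \<open>With \<open>g = r x - M x\<close>, the nonnegative form \<open>r |y|\<^sup>2 - y\<^sup>T M y\<close> vanishes at \<open>x\<close> and has
  first-order term \<open>2 t |g|\<^sup>2\<close> along \<open>x + t g\<close>.\<close>

lemma quad_form_maximizer_eigenvector:
  assumes sym: "\<And>i k. M i k = M k i"
    and le: "\<And>y. quad_form m M y \<le> r * (\<Sum>i<m. (y i)\<^sup>2)"
    and eq: "quad_form m M x = r * (\<Sum>i<m. (x i)\<^sup>2)"
  shows "\<forall>i<m. (\<Sum>k<m. M i k * x k) = r * x i"
proof -
  define g where "g = (\<lambda>i. r * x i - (\<Sum>k<m. M i k * x k))"
  define b where "b = r * (\<Sum>i<m. (g i)\<^sup>2) - quad_form m M g"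
  have "0 \<le> 2 * t * (\<Sum>i<m. (g i)\<^sup>2) + t\<^sup>2 * b" for t
  proof -
    have "0 \<le> r * (\<Sum>i<m. (x i + t * g i)\<^sup>2) - quad_form m M (\<lambda>i. x i + t * g i)"
      using le by simp
    also have "(\<Sum>i<m. (x i + t * g i)\<^sup>2)
        = (\<Sum>i<m. (x i)\<^sup>2 + 2 * t * (g i * x i) + t\<^sup>2 * (g i)\<^sup>2)"
      by (intro sum.cong) (simp_all add: algebra_simps power2_eq_square)
    also have "\<dots> = (\<Sum>i<m. (x i)\<^sup>2) + 2 * t * (\<Sum>i<m. g i * x i) + t\<^sup>2 * (\<Sum>i<m. (g i)\<^sup>2)"
      by (simp only: sum.distrib sum_distrib_left)
    also have "r * \<dots> - quad_form m M (\<lambda>i. x i + t * g i)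
        = 2 * t * (r * (\<Sum>i<m. g i * x i) - (\<Sum>i<m. g i * (\<Sum>k<m. M i k * x k))) + t\<^sup>2 * b"
      unfolding quad_form_add_scaled[OF sym] eq b_def by (simp add: algebra_simps)
    also have "r * (\<Sum>i<m. g i * x i) - (\<Sum>i<m. g i * (\<Sum>k<m. M i k * x k)) = (\<Sum>i<m. (g i)\<^sup>2)"
    proof -
      have "(g i)\<^sup>2 = r * (g i * x i) - g i * (\<Sum>k<m. M i k * x k)" for i
        unfolding power2_eq_square by (subst (2) g_def) (simp add: algebra_simps)
      then show ?thesis
        by (simp only: sum_subtractf sum_distrib_left[symmetric])
    qed
    finally show ?thesis .
  qed
  moreover have "b \<ge> 0"
    using le by (simp add: b_def)
  ultimately have "(\<Sum>i<m. (g i)\<^sup>2) = 0"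
    by (rule quadratic_nonneg_imp_zero)
  then have "\<forall>i<m. g i = 0"
    by (subst (asm) sum_nonneg_eq_0_iff) auto
  then show ?thesis
    by (simp add: g_def)
qed

section \<open>Codegrees as entries of the squared adjacency matrix\<close>

definition codegree :: "bigraph \<Rightarrow> nat \<Rightarrow> nat \<Rightarrow> nat" where
  "codegree G i k = card {j. (i, j) \<in> edges G \<and> (k, j) \<in> edges G}"

abbreviation codegree_form :: "bigraph \<Rightarrow> (nat \<Rightarrow> real) \<Rightarrow> real" where
  "codegree_form G \<equiv> quad_form (left_size G) (\<lambda>i k. real (codegree G i k))"

lemma codegree_commute: "codegree G i k = codegree G k i"
  unfolding codegree_def by (rule arg_cong[of _ _ card]) auto

lemma codegree_self: "codegree G i i = left_degree G i"
  by (simp add: codegree_def left_degree_def)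

lemma wf_bigraph_edgeD:
  assumes "wf_bigraph G" "(i, j) \<in> edges G"
  shows "i < left_size G" "j < right_size G"
  using assms by (auto simp: wf_bigraph_def)

lemma finite_neighbours:
  assumes "wf_bigraph G"
  shows "finite {j. (i, j) \<in> edges G}"
  by (rule finite_subset[of _ "{..<right_size G}"]) (use wf_bigraph_edgeD[OF assms] in auto)

text \<open>A codegree is the inner product of two rows of the biadjacency matrix \<open>B\<close>,
  so the codegrees form the matrix \<open>B B^T\<close>.\<close>

lemma codegree_eq_sum:
  assumes "wf_bigraph G"
  shows "real (codegree G i k) =
    (\<Sum>j<right_size G. of_bool ((i, j) \<in> edges G) * of_bool ((k, j) \<in> edges G))"
proof -
  have "{j. (i, j) \<in> edges G \<and> (k, j) \<in> edges G} =
      {j \<in> {..<right_size G}. (i, j) \<in> edges G \<and> (k, j) \<in> edges G}"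
    using wf_bigraph_edgeD[OF assms] by auto
  then show ?thesis
    by (simp add: codegree_def of_bool_conj[symmetric] Int_def)
qed

text \<open>This is \<open>(B B^T) x = B (B^T x)\<close>; the inner sum on the right is the entry of
  \<open>B^T x\<close> at \<open>w_j\<close>.\<close>

lemma sum_codegree_mult:
  assumes "wf_bigraph G"
  shows "(\<Sum>k<left_size G. real (codegree G i k) * x k) =
    (\<Sum>j<right_size G. of_bool ((i, j) \<in> edges G) *
      (\<Sum>k<left_size G. of_bool ((k, j) \<in> edges G) * x k))"
  unfolding codegree_eq_sum[OF assms] sum_distrib_left sum_distrib_right
  by (subst sum.swap) (simp only: mult.assoc)

section \<open>The block form of the adjacency matrix and its eigenvalues\<close>

lemma adjacency_mat_carrier:
  "adjacency_mat G \<in> carrier_mat (left_size G + right_size G) (left_size G + right_size G)"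
  by (simp add: adjacency_mat_def Let_def)

lemma sum_split_at: "(\<Sum>q\<in>{0..<m + n}. h q) = (\<Sum>q<m. h q) + (\<Sum>j<n. h (m + j :: nat))"
  for h :: "nat \<Rightarrow> real"
  by (induction n) (simp_all add: atLeast0LessThan add.assoc)

lemma adjacency_mat_mult_vec:
  assumes "v \<in> carrier_vec (left_size G + right_size G)" "p < left_size G + right_size G"
  shows "(adjacency_mat G *\<^sub>v v) $ p =
    (\<Sum>q<left_size G. adjacency_mat G $$ (p, q) * v $ q) +
    (\<Sum>j<right_size G. adjacency_mat G $$ (p, left_size G + j) * v $ (left_size G + j))"
proof -
  have "(adjacency_mat G *\<^sub>v v) $ p =
      (\<Sum>q\<in>{0..<left_size G + right_size G}. adjacency_mat G $$ (p, q) * v $ q)"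
    using assms adjacency_mat_carrier[of G] by (auto simp: scalar_prod_def intro!: sum.cong)
  then show ?thesis
    by (simp add: sum_split_at)
qed

lemma adjacency_mat_mult_vec_left:
  assumes "v \<in> carrier_vec (left_size G + right_size G)" "i < left_size G"
  shows "(adjacency_mat G *\<^sub>v v) $ i =
    (\<Sum>j<right_size G. of_bool ((i, j) \<in> edges G) * v $ (left_size G + j))"
proof -
  have "adjacency_mat G $$ (i, q) = 0" if "q < left_size G" for q
    using assms that by (simp add: adjacency_mat_def Let_def)
  moreover have "adjacency_mat G $$ (i, left_size G + j) = of_bool ((i, j) \<in> edges G)"
    if "j < right_size G" for j
    using assms that by (simp add: adjacency_mat_def Let_def)
  ultimately show ?thesis
    using assms by (simp add: adjacency_mat_mult_vec)
qed

lemma adjacency_mat_mult_vec_right: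
  assumes "v \<in> carrier_vec (left_size G + right_size G)" "j < right_size G"
  shows "(adjacency_mat G *\<^sub>v v) $ (left_size G + j) =
    (\<Sum>i<left_size G. of_bool ((i, j) \<in> edges G) * v $ i)"
proof -
  have "adjacency_mat G $$ (left_size G + j, q) = of_bool ((q, j) \<in> edges G)"
    if "q < left_size G" for q
    using assms that by (simp add: adjacency_mat_def Let_def)
  moreover have "adjacency_mat G $$ (left_size G + j, left_size G + k) = 0"
    if "k < right_size G" for k
    using assms that by (simp add: adjacency_mat_def Let_def)
  ultimately show ?thesis
    using assms by (simp add: adjacency_mat_mult_vec)
qed

text \<open>For a vector with blocks \<open>x\<close> on \<open>V\<close> and \<open>y\<close> on
  \<open>W\<close>, the eigenvalue equation reads \<open>B y = l x\<close> and
  \<open>B^T x = l y\<close>. Eliminating \<open>y\<close> gives \<open>B B^T x = l^2 x\<close>;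
  conversely \<open>y = B^T x / l\<close> restores the second block.\<close>

lemma nonzero_eigenvalue_iff_codegree:
  assumes wf: "wf_bigraph G" and "l \<noteq> 0"
  shows "l \<in> spectrum (adjacency_mat G) \<longleftrightarrow>
    (\<exists>x. (\<exists>i<left_size G. x i \<noteq> 0) \<and>
      (\<forall>i<left_size G. (\<Sum>k<left_size G. real (codegree G i k) * x k) = l\<^sup>2 * x i))"
    (is "?L \<longleftrightarrow> ?R")
proof -
  define m n A where "m = left_size G" and "n = right_size G" and "A = adjacency_mat G"
  define b where "b = (\<lambda>i j. of_bool ((i, j) \<in> edges G) :: real)"
  have A: "A \<in> carrier_mat (m + n) (m + n)"
    by (simp add: A_def m_def n_def adjacency_mat_carrier)
  have left: "(A *\<^sub>v v) $ i = (\<Sum>j<n. b i j * v $ (m + j))"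
    if "v \<in> carrier_vec (m + n)" "i < m" for v i
    using that adjacency_mat_mult_vec_left by (simp add: A_def b_def m_def n_def)
  have right: "(A *\<^sub>v v) $ (m + j) = (\<Sum>i<m. b i j * v $ i)"
    if "v \<in> carrier_vec (m + n)" "j < n" for v j
    using that adjacency_mat_mult_vec_right by (simp add: A_def b_def m_def n_def)
  have codegree: "(\<Sum>k<m. real (codegree G i k) * x k) = (\<Sum>j<n. b i j * (\<Sum>k<m. b k j * x k))"
    for i x
    using sum_codegree_mult[OF wf] by (simp add: b_def m_def n_def)
  show ?thesis
  proof
    assume ?L
    then obtain v where v: "v \<in> carrier_vec (m + n)" "v \<noteq> 0\<^sub>v (m + n)" "A *\<^sub>v v = l \<cdot>\<^sub>v v"
      using A by (auto simp: spectrum_def eigenvalue_def eigenvector_def A_def)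
    have eq1: "(\<Sum>j<n. b i j * v $ (m + j)) = l * v $ i" if "i < m" for i
      using left[OF v(1) that] v that by simp
    have eq2: "(\<Sum>k<m. b k j * v $ k) = l * v $ (m + j)" if "j < n" for j
      using right[OF v(1) that] v that by simp
    \<comment> \<open>If \<open>v\<close> vanished on \<open>V\<close>, then \<open>l\<close> times
      its \<open>W\<close> block would be 0 by \<open>eq2\<close>, and so \<open>v\<close> would be
      zero.\<close>
    have "\<exists>i<m. v $ i \<noteq> 0"
    proof (rule ccontr)
      assume *: "\<not> (\<exists>i<m. v $ i \<noteq> 0)"
      then have "v $ (m + j) = 0" if "j < n" for j
        using eq2[OF that] \<open>l \<noteq> 0\<close> by simp
      then have "v $ p = 0" if "p < m + n" for p
        using * that \<open>\<And>j. j < n \<Longrightarrow> v $ (m + j) = 0\<close>[of "p - m"] by (cases "p < m") auto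
      then show False
        using v(1,2) by (auto intro!: eq_vecI)
    qed
    moreover have "(\<Sum>k<m. real (codegree G i k) * v $ k) = l\<^sup>2 * v $ i" if "i < m" for i
    proof -
      have "(\<Sum>k<m. real (codegree G i k) * v $ k) = (\<Sum>j<n. b i j * (l * v $ (m + j)))"
        unfolding codegree using eq2 by (intro sum.cong) auto
      also have "\<dots> = l * (\<Sum>j<n. b i j * v $ (m + j))"
        by (simp add: sum_distrib_left mult_ac)
      also have "\<dots> = l\<^sup>2 * v $ i"
        using eq1[OF that] by (simp add: power2_eq_square)
      finally show ?thesis .
    qed
    ultimately show ?R
      unfolding m_def by (intro exI[of _ "\<lambda>i. v $ i"]) auto
  next
    assume ?R
    then obtain x i where x: "i < m" "x i \<noteq> 0"
      and eq: "\<And>i. i < m \<Longrightarrow> (\<Sum>k<m. real (codegree G i k) * x k) = l\<^sup>2 * x i"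
      unfolding m_def by blast
    \<comment> \<open>The \<open>W\<close> block is forced by the equation
      \<open>B^T x = l y\<close>.\<close>
    define v where "v = vec (m + n) (\<lambda>p. if p < m then x p else (\<Sum>k<m. b k (p - m) * x k) / l)"
    have v: "v \<in> carrier_vec (m + n)"
      by (simp add: v_def)
    have "v \<noteq> 0\<^sub>v (m + n)"
    proof
      assume "v = 0\<^sub>v (m + n)"
      then have "v $ i = 0"
        using x(1) by simp
      then show False
        using x by (simp add: v_def)
    qed
    moreover have "A *\<^sub>v v = l \<cdot>\<^sub>v v"
    proof (rule eq_vecI)
      fix p assume "p < dim_vec (l \<cdot>\<^sub>v v)"
      then have p: "p < m + n"
        using v by simp
      show "(A *\<^sub>v v) $ p = (l \<cdot>\<^sub>v v) $ p"
      proof (cases "p < m")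
        case True
        have "(\<Sum>j<n. b p j * v $ (m + j)) = (\<Sum>j<n. b p j * (\<Sum>k<m. b k j * x k)) / l"
          unfolding sum_divide_distrib by (intro sum.cong) (auto simp: v_def)
        also have "\<dots> = l * x p"
          using eq[OF True] \<open>l \<noteq> 0\<close> unfolding codegree by (simp add: power2_eq_square)
        finally show ?thesis
          using left[OF v True] True p by (simp add: v_def)
      next
        case False
        then obtain j where j: "p = m + j" "j < n"
          using p by (auto simp: not_less dest!: le_Suc_ex)
        have "(A *\<^sub>v v) $ (m + j) = (\<Sum>k<m. b k j * x k)"
          unfolding right[OF v j(2)] by (intro sum.cong) (auto simp: v_def)
        then show ?thesis
          using j \<open>l \<noteq> 0\<close> by (simp add: v_def)
      qed
    qed (use A v in auto)
    ultimately show ?L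
      using A v by (auto simp: spectrum_def eigenvalue_def eigenvector_def A_def[symmetric])
  qed
qed

text \<open>The maximal Rayleigh quotient \<open>r\<close> of the codegree matrix is attained at an
  eigenvector and is positive, so \<open>sqrt r\<close> is an eigenvalue of the adjacency matrix.
  Any positive eigenvalue \<open>l\<close> makes \<open>l^2\<close> a Rayleigh quotient, whence
  \<open>l \<le> sqrt r\<close>.\<close>

lemma lambda_max_codegree:
  assumes wf: "wf_bigraph G" and "no_isolated_vertices G" and pos: "0 < left_size G"
  shows lambda_max_pos: "0 < lambda_max G"
    and lambda_max_eigenvector: "\<exists>x. (\<exists>i<left_size G. x i \<noteq> 0) \<and>
      (\<forall>i<left_size G. (\<Sum>k<left_size G. real (codegree G i k) * x k) = (lambda_max G)\<^sup>2 * x i)"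
    and codegree_form_le_lambda_max:
      "codegree_form G y \<le> (lambda_max G)\<^sup>2 * (\<Sum>i<left_size G. (y i)\<^sup>2)"
proof -
  define m where "m = left_size G"
  define C where "C = (\<lambda>i k. real (codegree G i k))"
  obtain x where x: "(\<Sum>i<m. (x i)\<^sup>2) = 1"
    and max: "\<And>y. quad_form m C y \<le> quad_form m C x * (\<Sum>i<m. (y i)\<^sup>2)"
    using quad_form_maximizer[of m C] pos unfolding m_def by blast
  define r where "r = quad_form m C x"
  \<comment> \<open>The first unit vector: its Rayleigh quotient is the degree of
    \<open>v_0\<close>, which is positive as \<open>v_0\<close> is not isolated. This gives
    \<open>0 < r\<close>.\<close>
  define e where "e = (\<lambda>i::nat. if i = 0 then 1 else 0 :: real)"
  have e: "(\<Sum>k<m. h k * e k) = h 0" for h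
  proof -
    have "(\<Sum>k<m. h k * e k) = (\<Sum>k<m. if k = 0 then h 0 else 0)"
      by (intro sum.cong) (auto simp: e_def)
    then show ?thesis
      using pos by (simp add: m_def)
  qed
  have "real (left_degree G 0) = quad_form m C e"
    unfolding quad_form_eq_sum_mult e by (subst mult.commute) (simp add: e C_def codegree_self)
  also have "\<dots> \<le> r * (\<Sum>i<m. (e i)\<^sup>2)"
    unfolding r_def by (rule max)
  also have "(\<Sum>i<m. (e i)\<^sup>2) = 1"
    using e[of e] by (simp add: power2_eq_square e_def)
  finally have "real (left_degree G 0) \<le> r"
    by simp
  moreover have "0 < left_degree G 0"
  proof -
    have "finite {j. (0, j) \<in> edges G}"
      by (rule finite_neighbours[OF wf])
    then show ?thesis
      using assms(2) pos by (auto simp: left_degree_def card_gt_0_iff no_isolated_vertices_def)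
  qed
  ultimately have "0 < r"
    by linarith
  have C_commute: "C i k = C k i" for i k
    by (simp add: C_def codegree_commute)
  have eig: "\<forall>i<m. (\<Sum>k<m. C i k * x k) = r * x i"
    by (rule quad_form_maximizer_eigenvector[OF C_commute]) (use max x in \<open>simp_all add: r_def\<close>)
  have nz: "\<exists>i<m. x i \<noteq> 0"
  proof (rule ccontr)
    assume "\<not> (\<exists>i<m. x i \<noteq> 0)"
    then have "(\<Sum>i<m. (x i)\<^sup>2) = 0"
      by simp
    then show False
      using x by simp
  qed
  have "sqrt r \<in> spectrum (adjacency_mat G)"
    using eig nz \<open>0 < r\<close> nonzero_eigenvalue_iff_codegree[OF wf, of "sqrt r"]
    unfolding m_def C_def by auto
  moreover have "l \<le> sqrt r" if "l \<in> spectrum (adjacency_mat G)" for l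
  proof (cases "l \<le> 0")
    case True
    then show ?thesis
      using \<open>0 < r\<close> by (meson less_imp_le order_trans real_sqrt_ge_zero)
  next
    case False
    then obtain z where z: "\<exists>i<m. z i \<noteq> 0" "\<forall>i<m. (\<Sum>k<m. C i k * z k) = l\<^sup>2 * z i"
      using nonzero_eigenvalue_iff_codegree[OF wf, of l] \<open>l \<in> _\<close> unfolding m_def C_def by auto
    have "0 < (\<Sum>i<m. (z i)\<^sup>2)"
      using z(1) by (auto intro: sum_pos2)
    moreover have "l\<^sup>2 * (\<Sum>i<m. (z i)\<^sup>2) \<le> r * (\<Sum>i<m. (z i)\<^sup>2)"
      using max[of z] quad_form_eigenvector[OF z(2)] by (simp add: r_def)
    ultimately have "l\<^sup>2 \<le> r"
      by simp
    then show ?thesis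
      by (rule real_le_rsqrt)
  qed
  ultimately have "lambda_max G = sqrt r"
    unfolding lambda_max_def
    using card_finite_spectrum(1)[OF adjacency_mat_carrier] by (intro Max_eqI) auto
  then have pos_lambda: "0 < lambda_max G" and lambda: "(lambda_max G)\<^sup>2 = r"
    using \<open>0 < r\<close> by simp_all
  show "0 < lambda_max G"
    by (rule pos_lambda)
  show "\<exists>x. (\<exists>i<left_size G. x i \<noteq> 0) \<and>
      (\<forall>i<left_size G. (\<Sum>k<left_size G. real (codegree G i k) * x k) = (lambda_max G)\<^sup>2 * x i)"
    unfolding lambda using eig nz unfolding m_def C_def by blast
  show "codegree_form G y \<le> (lambda_max G)\<^sup>2 * (\<Sum>i<left_size G. (y i)\<^sup>2)"
    unfolding lambda using max[of y] unfolding r_def m_def C_def .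
qed

section \<open>The chain graph within its class, and renumbering by degree\<close>

lemma sorted_desc_nth_mono:
  assumes "sorted_wrt (\<ge>) (ds :: nat list)" "i \<le> k" "k < length ds"
  shows "ds ! k \<le> ds ! i"
  using assms by (cases "i = k") (auto simp: sorted_wrt_iff_nth_less)

text \<open>The head is the largest entry, so all neighbourhoods fit into \<open>W\<close> and
  \<open>v_0\<close> is adjacent to every vertex of \<open>W\<close>; positive entries leave no
  \<open>v_i\<close> isolated.\<close>

lemma chain_graph_mem_bigraph_class:
  assumes "ds \<noteq> []" "sorted_wrt (\<ge>) ds" "\<forall>d\<in>set ds. 0 < d"
  shows "chain_graph ds \<in> bigraph_class (mset ds)"
proof -
  have hd: "ds ! i \<le> hd ds" if "i < length ds" for i
    using sorted_desc_nth_mono[OF assms(2), of 0 i] that assms(1) by (simp add: hd_conv_nth)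
  have "wf_bigraph (chain_graph ds)"
    using hd by (fastforce simp: wf_bigraph_def chain_graph_def)
  moreover have "no_isolated_vertices (chain_graph ds)"
    using assms(1,3) unfolding no_isolated_vertices_def chain_graph_def
    by (auto simp: hd_conv_nth)
  moreover have "left_degrees (chain_graph ds) = mset ds"
  proof -
    have "left_degree (chain_graph ds) i = ds ! i" if "i < length ds" for i
      using that by (simp add: left_degree_def chain_graph_def lessThan_def[symmetric])
    then have "left_degrees (chain_graph ds) = image_mset (\<lambda>i. ds ! i) (mset_set {..<length ds})"
      by (auto simp: left_degrees_def chain_graph_def intro!: image_mset_cong)
    also have "\<dots> = mset (map (\<lambda>i. ds ! i) [0..<length ds])"
      by (simp only: mset_map mset_set_upto_eq_mset_upto)
    finally show ?thesis
      by (simp add: map_nth)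
  qed
  ultimately show ?thesis
    by (simp add: bigraph_class_def)
qed

lemma codegree_chain_graph:
  assumes "i < length ds" "k < length ds"
  shows "codegree (chain_graph ds) i k = min (ds ! i) (ds ! k)"
proof -
  have "{j. (i, j) \<in> edges (chain_graph ds) \<and> (k, j) \<in> edges (chain_graph ds)}
      = {..<min (ds ! i) (ds ! k)}"
    using assms by (auto simp: chain_graph_def)
  then show ?thesis
    by (simp add: codegree_def)
qed

text \<open>The class fixes the degrees only as a multiset. The permutation \<open>p\<close> lists
  the vertices of \<open>V\<close> in the order in which their degrees appear in
  \<open>ds\<close>.\<close>

lemma bigraph_class_permutation:
  assumes "G \<in> bigraph_class (mset ds)"
  obtains p where "left_size G = length ds" "p permutes {..<length ds}"
    "\<And>i. i < length ds \<Longrightarrow> left_degree G (p i) = ds ! i"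
proof -
  have deg: "image_mset (left_degree G) (mset_set {..<left_size G}) = mset ds"
    using assms by (simp add: bigraph_class_def left_degrees_def)
  have size: "left_size G = length ds"
    using arg_cong[OF deg, of size] by simp
  have "image_mset (\<lambda>i. ds ! i) (mset_set {..<length ds}) = mset (map (\<lambda>i. ds ! i) [0..<length ds])"
    by (simp only: mset_map mset_set_upto_eq_mset_upto)
  then have "image_mset (\<lambda>i. ds ! i) (mset_set {..<length ds})
      = image_mset (left_degree G) (mset_set {..<length ds})"
    using deg by (simp add: map_nth size)
  then obtain p where "p permutes {..<length ds}"
    "\<forall>i\<in>{..<length ds}. ds ! i = left_degree G (p i)"
    using image_mset_eq_implies_permutes[of "{..<length ds}"] by blast
  then show ?thesis
    using that size by simp
qed

section \<open>Comparison of codegree forms with that of the chain graph\<close>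

lemma codegree_le_min:
  assumes "wf_bigraph G"
  shows "codegree G i k \<le> min (left_degree G i) (left_degree G k)"
  using finite_neighbours[OF assms] unfolding codegree_def left_degree_def
  by (auto intro!: card_mono)

lemma quad_form_permute:
  assumes "p permutes {..<m}"
  shows "quad_form m M x = quad_form m (\<lambda>i k. M (p i) (p k)) (\<lambda>i. x (p i))"
proof -
  have bij: "bij_betw p {..<m} {..<m}"
    using assms by (rule permutes_imp_bij)
  show ?thesis
    unfolding quad_form_def
    by (subst (1 2) sum.reindex_bij_betw[OF bij, symmetric]) (rule refl)
qed

lemma quad_form_le_abs:
  assumes "\<And>i k. i < m \<Longrightarrow> k < m \<Longrightarrow> 0 \<le> M i k"
  shows "quad_form m M x \<le> quad_form m M (\<lambda>i. \<bar>x i\<bar>)"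
  unfolding quad_form_def
proof (intro sum_mono)
  fix i k assume "i \<in> {..<m}" "k \<in> {..<m}"
  then have "M i k * (x i * x k) \<le> M i k * (\<bar>x i\<bar> * \<bar>x k\<bar>)"
    using assms by (intro mult_left_mono) (auto simp: abs_mult[symmetric])
  then show "M i k * x i * x k \<le> M i k * \<bar>x i\<bar> * \<bar>x k\<bar>"
    by (simp add: mult.assoc)
qed

lemma quad_form_mono:
  assumes "\<And>i k. i < m \<Longrightarrow> k < m \<Longrightarrow> M i k \<le> N i k" "\<And>i. i < m \<Longrightarrow> 0 \<le> z i"
  shows "quad_form m M z \<le> quad_form m N z"
  unfolding quad_form_def using assms by (intro sum_mono mult_right_mono) auto

text \<open>A single strictly smaller entry enters the sum with the positive weight
  \<open>z i * z k\<close>, so it would make the whole form strictly smaller.\<close>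

lemma quad_form_mono_eqD:
  assumes le: "\<And>i k. i < m \<Longrightarrow> k < m \<Longrightarrow> M i k \<le> N i k" and pos: "\<And>i. i < m \<Longrightarrow> 0 < z i"
    and eq: "quad_form m N z \<le> quad_form m M z" and ik: "i < m" "k < m"
  shows "M i k = N i k"
proof (rule ccontr)
  assume "M i k \<noteq> N i k"
  then have "M i k * z i * z k < N i k * z i * z k"
    using le[OF ik] pos ik by (intro mult_strict_right_mono) auto
  moreover have le': "M i k * z i * z k \<le> N i k * z i * z k" if "i < m" "k < m" for i k
    using le[OF that] pos that by (intro mult_right_mono) (auto simp: less_imp_le)
  ultimately have "(\<Sum>k<m. M i k * z i * z k) < (\<Sum>k<m. N i k * z i * z k)"
    using ik by (intro sum_strict_mono_ex1) auto
  then have "quad_form m M z < quad_form m N z"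
    unfolding quad_form_def using ik le' by (intro sum_strict_mono_ex1) (auto intro!: sum_mono)
  then show False
    using eq by simp
qed

text \<open>With \<open>K\<close> the codegree matrix of \<open>G\<close> renumbered by
  \<open>p\<close> and \<open>C\<close> that of the chain graph \<open>H\<close>, the bound is the
  chain \<open>(lambda_max G)^2 * s \<le> quad_form m K z \<le> quad_form m C z \<le> (lambda_max
  H)^2 * s\<close>. Equal ends force equality throughout.\<close>

lemma lambda_max_le_chain_graph:
  assumes ds: "ds \<noteq> []" "sorted_wrt (\<ge>) ds" "\<forall>d\<in>set ds. 0 < d"
    and G: "G \<in> bigraph_class (mset ds)"
    and p: "p permutes {..<length ds}" "\<And>i. i < length ds \<Longrightarrow> left_degree G (p i) = ds ! i"
  shows "lambda_max G \<le> lambda_max (chain_graph ds)"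
    and "lambda_max G = lambda_max (chain_graph ds) \<Longrightarrow> i < length ds \<Longrightarrow> k < length ds \<Longrightarrow>
      codegree G (p i) (p k) = min (ds ! i) (ds ! k)"
proof -
  define m where "m = length ds"
  define H where "H = chain_graph ds"
  define K where "K = (\<lambda>i k. real (codegree G (p i) (p k)))"
  define C where "C = (\<lambda>i k. real (codegree H i k))"
  have m: "left_size G = m" "left_size H = m" "0 < m"
    using bigraph_class_permutation[OF G] ds(1) by (auto simp: m_def H_def chain_graph_def)
  have wf: "wf_bigraph G" "no_isolated_vertices G" "wf_bigraph H" "no_isolated_vertices H"
    using G chain_graph_mem_bigraph_class[OF ds] by (auto simp: bigraph_class_def H_def)
  have C: "C i k = min (ds ! i) (ds ! k)" if "i < m" "k < m" for i k
    using that codegree_chain_graph by (simp add: C_def H_def m_def)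
  have K_le: "K i k \<le> C i k" if "i < m" "k < m" for i k
    using C[OF that] codegree_le_min[OF wf(1), of "p i" "p k"] p(2) that
    by (simp add: K_def m_def)
  obtain x where x: "\<exists>i<m. x i \<noteq> 0"
    "\<forall>i<m. (\<Sum>k<m. real (codegree G i k) * x k) = (lambda_max G)\<^sup>2 * x i"
    using lambda_max_eigenvector[OF wf(1,2)] m by auto
  \<comment> \<open>Absolute values of the eigenvector in the renumbered order: nonnegativity is
    what allows the forms of \<open>K\<close> and \<open>C\<close> to be compared entrywise.\<close>
  define z where "z = (\<lambda>i. \<bar>x (p i)\<bar>)"
  define s where "s = (\<Sum>i<m. (z i)\<^sup>2)"
  have s: "s = (\<Sum>i<m. (x i)\<^sup>2)"
    using sum.reindex_bij_betw[OF permutes_imp_bij[OF p(1)], of "\<lambda>i. (x i)\<^sup>2"]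
    by (simp add: s_def z_def m_def)
  then have "0 < s"
    using x(1) by (auto intro: sum_pos2)
  have "(lambda_max G)\<^sup>2 * s = quad_form m K (\<lambda>i. x (p i))"
    using quad_form_eigenvector[OF x(2)] quad_form_permute[OF p(1), of "\<lambda>i k. real (codegree G i k)" x]
    by (simp add: s K_def m_def)
  also have "\<dots> \<le> quad_form m K z"
    unfolding z_def by (rule quad_form_le_abs) (simp add: K_def)
  finally have K_ge: "(lambda_max G)\<^sup>2 * s \<le> quad_form m K z" .
  have KC: "quad_form m K z \<le> quad_form m C z"
    using K_le by (rule quad_form_mono) (simp_all add: z_def)
  have C_max: "quad_form m C y \<le> (lambda_max H)\<^sup>2 * (\<Sum>i<m. (y i)\<^sup>2)" for y
    using codegree_form_le_lambda_max[OF wf(3,4)] m by (simp add: C_def)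
  have "(lambda_max G)\<^sup>2 * s \<le> (lambda_max H)\<^sup>2 * s"
    using K_ge KC C_max[of z] by (simp add: s_def)
  then have "(lambda_max G)\<^sup>2 \<le> (lambda_max H)\<^sup>2"
    using \<open>0 < s\<close> by simp
  then have "lambda_max G \<le> lambda_max H"
    by (rule power2_le_imp_le) (use lambda_max_pos[OF wf(3,4)] m in simp)
  then show "lambda_max G \<le> lambda_max (chain_graph ds)"
    by (simp add: H_def)
  assume eq: "lambda_max G = lambda_max (chain_graph ds)" and ik: "i < length ds" "k < length ds"
  \<comment> \<open>Both ends of the chain of inequalities now agree, so each of its links is an
    equality.\<close>
  have C_eq: "quad_form m C z = (lambda_max H)\<^sup>2 * s" and "quad_form m C z \<le> quad_form m K z"
    using K_ge KC C_max[of z] eq by (auto simp: s_def H_def)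
  have eig: "\<forall>i<m. (\<Sum>k<m. C i k * z k) = (lambda_max H)\<^sup>2 * z i"
  proof (rule quad_form_maximizer_eigenvector[OF _ C_max])
    show "C i k = C k i" for i k
      by (simp add: C_def codegree_commute)
  qed (use C_eq in \<open>simp add: s_def\<close>)
  obtain l where "l < m" "x l \<noteq> 0"
    using x(1) by blast
  moreover obtain l' where "l = p l'" "l' < m"
    using \<open>l < m\<close> p(1) permutes_image[OF p(1)] by (auto simp: m_def)
  ultimately have l': "l' < m" "0 < z l'"
    by (auto simp: z_def)
  \<comment> \<open>A Perron-Frobenius argument: \<open>C\<close> has positive entries and
    \<open>z\<close> is nonnegative with a positive entry at \<open>l'\<close>, so
    \<open>C z\<close> is positive everywhere. As \<open>C z\<close> is a multiple of
    \<open>z\<close> by a square, \<open>z\<close> is positive too.\<close>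
  have C_pos: "0 < C i k" if "i < m" "k < m" for i k
    using C[OF that] ds(3) that by (simp add: m_def)
  have "0 < z i" if "i < m" for i
  proof -
    have "0 < (\<Sum>k<m. C i k * z k)"
      using l' C_pos[OF that] by (intro sum_pos2[of _ l']) (auto simp: z_def less_imp_le)
    then have "0 < (lambda_max H)\<^sup>2 * z i"
      using eig that by simp
    then show ?thesis
      by (simp add: zero_less_mult_iff)
  qed
  then have "K i k = C i k"
    using K_le ik \<open>quad_form m C z \<le> quad_form m K z\<close> unfolding m_def
    by (intro quad_form_mono_eqD[of "length ds" K C z]) auto
  then show "codegree G (p i) (p k) = min (ds ! i) (ds ! k)"
    using C ik by (simp add: K_def m_def)
qed

section \<open>Recovering the chain graph from its codegrees\<close>

lemma down_closed_eq_lessThan: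
  fixes S :: "nat set"
  assumes "finite S" and "\<And>i k. k \<in> S \<Longrightarrow> i \<le> k \<Longrightarrow> i \<in> S"
  shows "S = {..<card S}"
proof (cases "S = {}")
  case False
  then have "Max S \<in> S"
    by (rule Max_in[OF assms(1)])
  then have "S = {..<Suc (Max S)}"
    using assms(2)[OF \<open>Max S \<in> S\<close>] Max_ge[OF assms(1)] by (auto simp: less_Suc_eq_le)
  then show ?thesis
    by (metis card_lessThan)
qed simp

text \<open>The codegrees force the neighbourhoods of \<open>p 0, p 1, \<dots>\<close> to decrease, so sorting \<open>W\<close> by
  decreasing degree turns each of them into an initial segment.\<close>

lemma bigraph_iso_chain_graph:
  assumes ds: "ds \<noteq> []" "sorted_wrt (\<ge>) ds"
    and wf: "wf_bigraph G" and iso: "no_isolated_vertices G" and size: "left_size G = length ds"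
    and p: "p permutes {..<length ds}"
    and codegree: "\<And>i k. i < length ds \<Longrightarrow> k < length ds \<Longrightarrow>
      codegree G (p i) (p k) = min (ds ! i) (ds ! k)"
  shows "bigraph_iso G (chain_graph ds)"
proof -
  define m n where "m = length ds" and "n = right_size G"
  define N where "N = (\<lambda>i. {j. (p i, j) \<in> edges G})"
  have N_sub: "N i \<subseteq> {..<n}" for i
    using wf_bigraph_edgeD[OF wf] by (auto simp: N_def n_def)
  then have fin: "finite (N i)" for i
    by (rule finite_subset) simp
  have card_N: "card (N i) = ds ! i" if "i < m" for i
    using codegree[of i i] that by (simp add: codegree_self left_degree_def N_def m_def)
  \<comment> \<open>The intersection of \<open>N i\<close> and \<open>N k\<close> has
    \<open>min (ds ! i) (ds ! k) = ds ! k\<close> elements, as many as \<open>N k\<close>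
    itself.\<close>
  have N_mono: "N k \<subseteq> N i" if "i \<le> k" "k < m" for i k
  proof -
    have "card (N i \<inter> N k) = codegree G (p i) (p k)"
      unfolding codegree_def N_def by (rule arg_cong[of _ _ card]) auto
    also have "\<dots> = card (N k)"
      using codegree[of i k] card_N[of k] sorted_desc_nth_mono[OF ds(2), of i k] that
      by (simp add: m_def)
    finally have "N i \<inter> N k = N k"
      using fin by (intro card_subset_eq) auto
    then show ?thesis
      by blast
  qed
  \<comment> \<open>Each \<open>w_j\<close> has some neighbour, and by nesting \<open>p 0\<close> is
    then one as well. Hence \<open>W\<close> has exactly \<open>hd ds\<close> vertices.\<close>
  have "j \<in> N 0" if j: "j < n" for j
  proof -
    obtain i where i: "(i, j) \<in> edges G"
      using iso j by (auto simp: no_isolated_vertices_def n_def)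
    then have "i \<in> p ` {..<m}"
      using wf_bigraph_edgeD(1)[OF wf i] permutes_image[OF p] by (simp add: size m_def)
    then obtain k where "k < m" "i = p k"
      by blast
    then show ?thesis
      using i N_mono[of 0 k] by (auto simp: N_def)
  qed
  then have "N 0 = {..<n}"
    using N_sub by auto
  then have n: "n = hd ds"
    using card_N[of 0] ds(1) by (simp add: hd_conv_nth m_def)
  \<comment> \<open>The degree of \<open>w_j\<close>. By nesting, its neighbours are exactly
    \<open>p 0, ..., p (c j - 1)\<close>.\<close>
  define c where "c = (\<lambda>j. card {i. i < m \<and> j \<in> N i})"
  have N_iff: "j \<in> N i \<longleftrightarrow> i < c j" if "i < m" for i j
  proof -
    have "{i. i < m \<and> j \<in> N i} = {..<c j}"
      unfolding c_def using N_mono by (intro down_closed_eq_lessThan) (auto dest: le_less_trans)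
    then have "i \<in> {i. i < m \<and> j \<in> N i} \<longleftrightarrow> i < c j"
      by blast
    then show ?thesis
      using that by simp
  qed
  have c_le: "c j \<le> m" for j
    unfolding c_def using card_mono[of "{..<m}" "{i. i < m \<and> j \<in> N i}"] by auto
  \<comment> \<open>\<open>sort_key\<close> sorts upwards, so the key \<open>m - c j\<close> puts
    large degrees first; the truncated subtraction loses nothing because
    \<open>c j \<le> m\<close>.\<close>
  define js where "js = sort_key (\<lambda>j. m - c j) [0..<n]"
  have js: "length js = n" "distinct js" "set js = {..<n}"
    by (auto simp: js_def)
  have c_mono: "c (js ! t) \<le> c (js ! u)" if "u \<le> t" "t < n" for t u
  proof -
    have "sorted (map (\<lambda>j. m - c j) js)"
      by (simp add: js_def)
    then have "m - c (js ! u) \<le> m - c (js ! t)"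
      using that js(1) sorted_nth_mono[of "map (\<lambda>j. m - c j) js" u t] by simp
    then show ?thesis
      using c_le[of "js ! u"] c_le[of "js ! t"] by linarith
  qed
  have bij: "bij_betw (\<lambda>t. js ! t) {..<n} {..<n}"
    using js by (intro bij_betw_nth) auto
  \<comment> \<open>The position of a vertex of \<open>W\<close> in the sorted list.\<close>
  define g where "g = inv_into {..<n} (\<lambda>t. js ! t)"
  have bij_g: "bij_betw g {..<n} {..<n}"
    unfolding g_def by (rule bij_betw_inv_into[OF bij])
  have mem_iff: "j \<in> N i \<longleftrightarrow> g j < ds ! i" if "i < m" "j < n" for i j
  proof -
    \<comment> \<open>The positions occupied by \<open>N i\<close>. Since degrees decrease along
      \<open>js\<close> and membership in \<open>N i\<close> is a lower bound on the degree, they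
      form an initial segment, of length \<open>card (N i) = ds ! i\<close>.\<close>
    define T where "T = {t. t < n \<and> js ! t \<in> N i}"
    have T: "T = {..<card T}"
      using c_mono N_iff[OF that(1)] unfolding T_def
      by (intro down_closed_eq_lessThan) (auto intro: less_le_trans dest: le_less_trans)
    have "N i \<subseteq> (\<lambda>t. js ! t) ` {..<n}"
      using N_sub[of i] bij_betw_imp_surj_on[OF bij] by simp
    then have "(\<lambda>t. js ! t) ` T = N i"
      by (auto simp: T_def)
    moreover have "inj_on (\<lambda>t. js ! t) T"
      by (rule inj_on_subset[OF bij_betw_imp_inj_on[OF bij]]) (auto simp: T_def)
    ultimately have card_T: "card T = ds ! i"
      using card_N[OF that(1)] card_image by metis
    have "T = {..<ds ! i}"
      using T unfolding card_T .
    then have "g j \<in> T \<longleftrightarrow> g j < ds ! i"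
      by simp
    moreover have "g j < n" "js ! g j = j"
      using bij_betwE[OF bij_g] bij_betw_inv_into_right[OF bij] that(2) by (auto simp: g_def)
    ultimately show ?thesis
      by (simp add: T_def)
  qed
  \<comment> \<open>\<open>p\<close> leads from positions in \<open>ds\<close> to vertices of
    \<open>G\<close>, so the isomorphism onto the chain graph uses its inverse.\<close>
  define f where "f = inv_into UNIV p"
  have "bij_betw f {..<m} {..<m}"
    using permutes_imp_bij[OF permutes_inv[OF p]] by (simp add: m_def f_def)
  moreover have "(i, j) \<in> edges G \<longleftrightarrow> (f i, g j) \<in> edges (chain_graph ds)"
    if "i < m" "j < n" for i j
  proof -
    have "f i < m"
      using \<open>bij_betw f {..<m} {..<m}\<close> that(1) bij_betwE by blast
    moreover have "p (f i) = i"
      using permutes_inverses(1)[OF p] by (simp add: f_def)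
    ultimately show ?thesis
      using mem_iff[of "f i" j] that(2) by (simp add: N_def chain_graph_def m_def)
  qed
  ultimately show ?thesis
    unfolding bigraph_iso_def using bij_g n
    by (intro exI[of _ f] exI[of _ g]) (simp add: size m_def n_def chain_graph_def)
qed

theorem theorem3p1:
  fixes ds :: "nat list"
  assumes "ds \<noteq> []"
    and "sorted_wrt (\<ge>) ds"
    and "\<forall>d\<in>set ds. 0 < d"
  shows "is_arg_max lambda_max (\<lambda>G. G \<in> bigraph_class (mset ds)) (chain_graph ds) \<and>
    (\<forall>G. is_arg_max lambda_max (\<lambda>G. G \<in> bigraph_class (mset ds)) G
         \<longrightarrow> bigraph_iso G (chain_graph ds))"
proof -
  have mem: "chain_graph ds \<in> bigraph_class (mset ds)"
    using assms by (rule chain_graph_mem_bigraph_class)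
  have le: "lambda_max G \<le> lambda_max (chain_graph ds)" if G: "G \<in> bigraph_class (mset ds)" for G
    using bigraph_class_permutation[OF G] lambda_max_le_chain_graph(1)[OF assms G] by metis
  have "bigraph_iso G (chain_graph ds)"
    if arg_max: "is_arg_max lambda_max (\<lambda>G. G \<in> bigraph_class (mset ds)) G" for G
  proof -
    have G: "G \<in> bigraph_class (mset ds)"
      using arg_max by (simp add: is_arg_max_def)
    have "lambda_max G = lambda_max (chain_graph ds)"
      using arg_max le[OF G] mem unfolding is_arg_max_def by force
    moreover obtain p where "left_size G = length ds" "p permutes {..<length ds}"
      "\<And>i. i < length ds \<Longrightarrow> left_degree G (p i) = ds ! i"
      using bigraph_class_permutation[OF G] by blast
    ultimately show ?thesis
      using bigraph_iso_chain_graph[OF assms(1,2)] lambda_max_le_chain_graph(2)[OF assms G] G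
      by (simp add: bigraph_class_def)
  qed
  then show ?thesis
    using mem le by (auto simp: is_arg_max_def not_less)
qed

end
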